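(* Let $n,d\ge 1$ be integers and let $Z\subset Q^n_1$. If $\omega_d(Z)=\omega>0$, then the Remez $d$-span $R_d(Z)$ is finite and satisfies $$R_d(Z)\le T_d\left(\frac{1+(1-\omega)^{1/n}}{1-(1-\omega)^{1/n}}\right),$$ where $T_d(x)=\cos(d\arccos x)$ is the $d$-th Chebyshev polynomial.
   Context: $Q^n_1=[0,1]^n\subset\mathbb{R}^n$ is the unit cube and $\mu_n$ is Lebesgue measure on $\mathbb{R}^n$. For a bounded set $A\subset\mathbb{R}^n$ and $\varepsilon>0$, $M(\varepsilon,A)$ is the minimal number of closed axis-parallel cubes of edge length $\varepsilon$ covering $A$. For a real polynomial $P$ on $\mathbb{R}^n$ and $\rho\ge 0$ put $V_\rho(P)=\{x\in Q^n_1: |P(x)|\le\rho\}$. Vitushkin's bound (a known result) states that there are positive constants $C_i(n,d)$, $0\le i\le n-1$, depending only on $n,d$, such that for every real polynomial $P$ in $n$ variables of degree at most $d$, every $\rho\ge0$ and every $\varepsilon>0$, $$M(\varepsilon,V_\rho(P))\le\sum_{i=0}^{n-1}C_i(n,d)\varepsilon^{-i}+\mu_n(V_\rho(P))\varepsilon^{-n}.$$ Such constants are fixed: $C_0(1,d)=d$; $C_0(2,d)=(2d-1)^2$, $C_1(2,d)=8d$; in general they have the form $C_i(n,d)=C_i'(n)(2d)^{n-i}$. Put $M_d(\varepsilon)=\sum_{i=0}^{n-1}C_i(n,d)\varepsilon^{-i}$. For $Z\subset Q^n_1$ the metric $d$-span of $Z$ is $$\omega_d(Z)=\sup_{\varepsilon>0}\varepsilon^n\,[M(\varepsilon,Z)-M_d(\varepsilon)].$$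 A set $Z\subset Q^n_1$ is $d$-definite if there is a constant $C(d,Z)$ such that every real polynomial $P(x_1,\dots,x_n)$ of degree at most $d$ with $|P|\le 1$ on $Z$ satisfies $|P|\le C(d,Z)$ on $Q^n_1$. The minimum of all such constants is the Remez $d$-span $R_d(Z)$ (it is $\infty$ if $Z$ is not $d$-definite). *)

theory Defs
  imports "HOL-Analysis.Analysis" "HOL-Computational_Algebra.Polynomial"
begin

(* cbox 0 1 is the unit cube Q^n_1; vec e is the constant vector (e, ..., e). *)

definition covering_number :: "real \<Rightarrow> (real ^ 'n) set \<Rightarrow> nat" where
  "covering_number e A =
     (LEAST k. \<exists>\<Q>. finite \<Q> \<and> card \<Q> = k \<and> \<Q> \<subseteq> range (\<lambda>a. cbox a (a + vec e)) \<and> A \<subseteq> \<Union>\<Q>)"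

(* The minimum is over a nonempty set for bounded A. *)
lemma covering_number_attained:
  fixes A :: "(real ^ 'n) set"
  assumes "bounded A" and "e > 0"
  shows "\<exists>\<Q>. finite \<Q> \<and> card \<Q> = covering_number e A \<and>
           \<Q> \<subseteq> range (\<lambda>a. cbox a (a + vec e)) \<and> A \<subseteq> \<Union>\<Q>"
proof -
  have "compact (closure A)"
    using assms(1) by (simp add: compact_closure)
  moreover have "closure A \<subseteq> (\<Union>a\<in>UNIV. box a (a + vec e))"
  proof
    fix x :: "real ^ 'n"
    have "x \<in> box (x - vec (e/2)) (x - vec (e/2) + vec e)"
      using assms(2) by (simp add: mem_box_cart)
    then show "x \<in> (\<Union>a\<in>UNIV. box a (a + vec e))" by blast
  qed
  ultimately obtain K where K: "finite K" "closure A \<subseteq> (\<Union>a\<in>K. box a (a + vec e))"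
    by (metis (lifting) compactE_image open_box)
  let ?Q = "(\<lambda>a. cbox a (a + vec e)) ` K"
  have "A \<subseteq> \<Union>?Q"
    using K(2) closure_subset[of A] box_subset_cbox by blast
  then have "\<exists>k \<Q>. finite \<Q> \<and> card \<Q> = k \<and>
      \<Q> \<subseteq> range (\<lambda>a. cbox a (a + vec e)) \<and> A \<subseteq> \<Union>\<Q>"
    using K(1) by (intro exI[of _ "card ?Q"] exI[of _ ?Q]) auto
  from LeastI_ex[OF this] show ?thesis
    unfolding covering_number_def .
qed

(* Total degree; over the reals a polynomial is determined by its polynomial function. *)
definition polynomial_of_degree_le :: "nat \<Rightarrow> (real ^ 'n \<Rightarrow> real) \<Rightarrow> bool" where
  "polynomial_of_degree_le d P \<longleftrightarrow>
     (\<exists>c :: ('n \<Rightarrow> nat) \<Rightarrow> real. \<forall>x.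
        P x = (\<Sum>\<alpha> | (\<Sum>i\<in>UNIV. \<alpha> i) \<le> d. c \<alpha> * (\<Prod>i\<in>UNIV. x $ i ^ \<alpha> i)))"

(* The sum above ranges over a finite set. *)
lemma finite_multiindices: "finite {\<alpha> :: 'n::finite \<Rightarrow> nat. (\<Sum>i\<in>UNIV. \<alpha> i) \<le> d}"
proof (rule finite_subset)
  show "{\<alpha> :: 'n \<Rightarrow> nat. (\<Sum>i\<in>UNIV. \<alpha> i) \<le> d} \<subseteq> PiE UNIV (\<lambda>_. {..d})"
  proof
    fix \<alpha> :: "'n \<Rightarrow> nat"
    assume "\<alpha> \<in> {\<alpha>. (\<Sum>i\<in>UNIV. \<alpha> i) \<le> d}"
    then have s: "(\<Sum>i\<in>UNIV. \<alpha> i) \<le> d" by simp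
    have "\<alpha> i \<le> d" for i
      using member_le_sum[of i UNIV \<alpha>] s by simp
    then show "\<alpha> \<in> PiE UNIV (\<lambda>_. {..d})" by auto
  qed
  show "finite (PiE (UNIV :: 'n set) (\<lambda>_. {..d}))" by (rule finite_PiE) auto
qed

definition sublevel :: "real \<Rightarrow> (real ^ 'n \<Rightarrow> real) \<Rightarrow> (real ^ 'n) set" where
  "sublevel \<rho> P = {x \<in> cbox 0 1. \<bar>P x\<bar> \<le> \<rho>}"

(* M_d(e) for the constants C i = C_i(n,d), with n and d fixed. *)
definition vitushkin_sum :: "nat \<Rightarrow> (nat \<Rightarrow> real) \<Rightarrow> real \<Rightarrow> real" where
  "vitushkin_sum n C e = (\<Sum>i<n. C i / e ^ i)"

(* C 0, ..., C (n-1) are admissible choices of C_0(n,d), ..., C_{n-1}(n,d), n = CARD('n),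
   in Vitushkin's bound. *)
definition vitushkin_constants :: "'n::finite itself \<Rightarrow> nat \<Rightarrow> (nat \<Rightarrow> real) \<Rightarrow> bool" where
  "vitushkin_constants _ d C \<longleftrightarrow>
     (\<forall>i<CARD('n). C i > 0) \<and>
     (\<forall>(P :: real ^ 'n \<Rightarrow> real) \<rho> e.
        polynomial_of_degree_le d P \<longrightarrow> \<rho> \<ge> 0 \<longrightarrow> e > 0 \<longrightarrow>
        real (covering_number e (sublevel \<rho> P)) \<le>
          vitushkin_sum CARD('n) C e + measure lebesgue (sublevel \<rho> P) / e ^ CARD('n))"

definition metric_span :: "(nat \<Rightarrow> real) \<Rightarrow> (real ^ 'n) set \<Rightarrow> ereal" where
  "metric_span C Z =
     (SUP e\<in>{0<..}. ereal (e ^ CARD('n) * (real (covering_number e Z) - vitushkin_sum CARD('n) C e)))"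

definition remez_constant :: "nat \<Rightarrow> (real ^ 'n) set \<Rightarrow> real \<Rightarrow> bool" where
  "remez_constant d Z K \<longleftrightarrow>
     (\<forall>P. polynomial_of_degree_le d P \<longrightarrow> (\<forall>x\<in>Z. \<bar>P x\<bar> \<le> 1) \<longrightarrow> (\<forall>x\<in>cbox 0 1. \<bar>P x\<bar> \<le> K))"

definition definite :: "nat \<Rightarrow> (real ^ 'n) set \<Rightarrow> bool" where
  "definite d Z \<longleftrightarrow> (\<exists>K. remez_constant d Z K)"

definition remez_span :: "nat \<Rightarrow> (real ^ 'n) set \<Rightarrow> ereal" where
  "remez_span d Z = (if definite d Z then ereal (LEAST K. remez_constant d Z K) else \<infinity>)"

(* The minimum exists for d-definite sets. *)
lemma remez_constant_Least:
  fixes Z :: "(real ^ 'n) set"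
  assumes "definite d Z"
  shows "remez_constant d Z (LEAST K. remez_constant d Z K)"
    and "remez_constant d Z K \<Longrightarrow> (LEAST K. remez_constant d Z K) \<le> K"
proof -
  let ?S = "{K. remez_constant d Z K}"
  have ne: "?S \<noteq> {}" using assms by (auto simp: definite_def)
  have zero: "polynomial_of_degree_le d (\<lambda>x :: real ^ 'n. 0)"
    unfolding polynomial_of_degree_le_def by (intro exI[of _ "\<lambda>_. 0"]) simp
  have mem0: "(0 :: real ^ 'n) \<in> cbox 0 1" by (simp add: mem_box_cart)
  have ge0: "0 \<le> K" if K: "remez_constant d Z K" for K
  proof -
    have "\<forall>x\<in>cbox 0 1. \<bar>(\<lambda>x :: real ^ 'n. 0 :: real) x\<bar> \<le> K"
      using K zero unfolding remez_constant_def by (metis abs_zero zero_le_one)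
    then show ?thesis using mem0 by auto
  qed
  then have bdd: "bdd_below ?S" by (intro bdd_belowI[of _ 0]) auto
  have inS: "remez_constant d Z (Inf ?S)"
  proof (rule remez_constant_def[THEN iffD2], intro allI impI ballI)
    fix P and x :: "real ^ 'n"
    assume "polynomial_of_degree_le d P" "\<forall>x\<in>Z. \<bar>P x\<bar> \<le> 1" "x \<in> cbox 0 1"
    then show "\<bar>P x\<bar> \<le> Inf ?S"
      using ne by (intro cInf_greatest) (auto simp: remez_constant_def)
  qed
  have le: "Inf ?S \<le> K" if "remez_constant d Z K" for K
    using that bdd by (intro cInf_lower) auto
  have eq: "(LEAST K. remez_constant d Z K) = Inf ?S"
    using inS le by (rule Least_equality)
  show "remez_constant d Z (LEAST K. remez_constant d Z K)" using inS eq by simp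
  show "(LEAST K. remez_constant d Z K) \<le> K" if "remez_constant d Z K"
    using le[OF that] eq by simp
qed

(* Isabelle's real arccos is meaningful on [-1,1] only, but T_d is evaluated at points >= 1,
   so T_d has to be the polynomial given by the cosine formula on [-1,1]. *)
definition chebyshev_poly :: "nat \<Rightarrow> real poly" where
  "chebyshev_poly d = (THE p. \<forall>x\<in>{-1..1}. poly p x = cos (real d * arccos x))"

lemma ex1_chebyshev_poly:
  "\<exists>!p :: real poly. \<forall>x\<in>{-1..1}. poly p x = cos (real d * arccos x)"
proof -
  have "(\<exists>p :: real poly. \<forall>x\<in>{-1..1}. poly p x = cos (real d * arccos x)) \<and>
        (\<exists>p :: real poly. \<forall>x\<in>{-1..1}. poly p x = cos (real (Suc d) * arccos x))"
  proof (induction d)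
    case 0
    have "\<forall>x\<in>{-1..1}. poly [:1:] x = cos (real 0 * arccos x)" by simp
    moreover have "\<forall>x\<in>{-1..1}. poly [:0, 1:] x = cos (real (Suc 0) * arccos x)"
      by (simp add: cos_arccos)
    ultimately show ?case by blast
  next
    case (Suc d)
    then obtain p q where pq:
      "\<forall>x\<in>{-1..1}. poly p x = cos (real d * arccos x)"
      "\<forall>x\<in>{-1..1}. poly q x = cos (real (Suc d) * arccos x)" by blast
    have "\<forall>x\<in>{-1..1}. poly ([:0, 2:] * q - p) x = cos (real (Suc (Suc d)) * arccos x)"
    proof
      fix x :: real assume x: "x \<in> {-1..1}"
      define t where "t = arccos x"
      have ct: "cos t = x" using x by (simp add: t_def cos_arccos)
      have sum: "cos (real (Suc (Suc d)) * t) + cos (real d * t)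
          = 2 * cos t * cos (real (Suc d) * t)"
        using cos_add[of "real (Suc d) * t" t] cos_diff[of "real (Suc d) * t" t]
        by (simp add: algebra_simps)
      have "poly p x = cos (real d * t)" "poly q x = cos (real (Suc d) * t)"
        using pq x unfolding t_def by blast+
      then have "poly ([:0, 2:] * q - p) x = 2 * cos t * cos (real (Suc d) * t) - cos (real d * t)"
        unfolding ct by simp
      also have "\<dots> = cos (real (Suc (Suc d)) * t)" using sum by linarith
      finally show "poly ([:0, 2:] * q - p) x = cos (real (Suc (Suc d)) * arccos x)"
        unfolding t_def .
    qed
    with pq(2) show ?case by blast
  qed
  moreover have "p = q"
    if "\<forall>x\<in>{-1..1}. poly p x = cos (real d * arccos x)"
       "\<forall>x\<in>{-1..1}. poly q x = cos (real d * arccos x)" for p q :: "real poly"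
  proof (rule ccontr)
    assume "p \<noteq> q"
    then have "finite {x. poly (p - q) x = 0}" by (intro poly_roots_finite) simp
    moreover have "{-1..1} \<subseteq> {x. poly (p - q) x = 0}" using that by auto
    ultimately have "finite {-1..1::real}" by (rule finite_subset[rotated])
    with infinite_Icc[of "-1" "1::real"] show False by simp
  qed
  ultimately show ?thesis by blast
qed

end

theory Submission
  imports Defs
begin

text \<open>
  Let \<open>P\<close> have degree at most \<open>d\<close> and satisfy \<open>|P| \<le> 1\<close> on \<open>Z\<close>. Then \<open>Z\<close> lies in the sublevel set \<open>V\<close>
  of the points of the cube with \<open>|P| \<le> 1\<close>. The covering numbers of \<open>V\<close> dominate those of \<open>Z\<close>, and
  Vitushkin's bound for \<open>V\<close> shows that the metric span \<open>\<omega>\<close> of \<open>Z\<close> is at most the volume of \<open>V\<close>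
  (\<open>metric_span_le_measure_sublevel\<close>). It remains to bound \<open>P\<close> on the cube by a quantity depending only
  on a lower bound for this volume, which is the inequality of Brudnyi and Ganzburg
  (\<open>brudnyi_ganzburg_inequality\<close>), proved here for compact convex bodies of positive measure.

  That inequality reduces to one variable along rays. Fix a point \<open>x\<close> of the body \<open>K\<close>. If on every
  ray from \<open>x\<close> the set \<open>|P| > 1\<close> filled at least a fraction \<open>\<tau>\<close> of the part in \<open>K\<close>, then, because the
  volume element in polar coordinates grows with the distance from \<open>x\<close>, its volume would be at
  least that of \<open>K\<close> shrunk towards \<open>x\<close> by the factor \<open>\<tau>\<close>. With \<open>n\<close> the dimension, this is impossible when
  \<open>\<tau>\<^sup>n > 1 - \<omega>\<close>. So on some ray the set \<open>|P| \<le> 1\<close> fills more than the fraction \<open>1 - \<tau>\<close>, and Remez'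
  inequality for polynomials in one variable bounds \<open>|P x|\<close> by \<open>T\<^sub>d((1 + \<tau>)/(1 - \<tau>))\<close>.

  Remez' inequality at an endpoint (\<open>remez_inequality_endpoint\<close>) follows from Lagrange interpolation
  at points of the set \<open>|p| \<le> 1\<close> that are spaced, in terms of the measure of this set, like the
  extremal points of \<open>T\<^sub>d\<close>. The polar coordinates enter only through a comparison of integrals along
  rays (\<open>nn_integral_mono_on_rays\<close>).
\<close>

section \<open>Lagrange interpolation and Chebyshev polynomials\<close>

lemma lagrange_interpolation:
  fixes p :: "'a::field poly" and x :: "nat \<Rightarrow> 'a"
  assumes inj: "inj_on x {..d}" and deg: "degree p \<le> d"
  shows "poly p y = (\<Sum>j\<le>d. poly p (x j) * (\<Prod>i\<in>{..d} - {j}. (y - x i) / (x j - x i)))"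
proof -
  define L where
    "L = (\<Sum>j\<le>d. smult (poly p (x j)) (\<Prod>i\<in>{..d} - {j}. smult (1 / (x j - x i)) [:- x i, 1:]))"
  have poly_L: "poly L z = (\<Sum>j\<le>d. poly p (x j) * (\<Prod>i\<in>{..d} - {j}. (z - x i) / (x j - x i)))" for z
    by (simp add: L_def poly_sum poly_prod diff_divide_distrib)
  have "degree (\<Prod>i\<in>{..d} - {j}. smult (1 / (x j - x i)) [:- x i, 1:]) \<le> d" if "j \<le> d" for j
  proof -
    have "degree (smult c [:- z, 1:]) \<le> 1" for c z :: 'a
      by (rule order_trans[OF degree_smult_le]) simp
    then have "degree (\<Prod>i\<in>{..d} - {j}. smult (1 / (x j - x i)) [:- x i, 1:])
        \<le> (\<Sum>i\<in>{..d} - {j}. 1)"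
      by (intro order_trans[OF degree_prod_sum_le] sum_mono) (simp_all only: comp_apply finite_Diff finite_atMost)
    also have "\<dots> = d"
      using that by simp
    finally show ?thesis .
  qed
  then have "degree L \<le> d"
    unfolding L_def by (intro degree_sum_le) (auto intro: order_trans[OF degree_smult_le])
  moreover have "poly L (x k) = poly p (x k)" if "k \<le> d" for k
  proof -
    have "(\<Prod>i\<in>{..d} - {j}. (x k - x i) / (x j - x i)) = (if j = k then 1 else 0)" if "j \<le> d" for j
    proof (cases "j = k")
      case True
      then show ?thesis
        using that inj by (auto intro!: prod.neutral split: if_splits dest: inj_onD[OF inj])
    next
      case False
      then show ?thesis
        using \<open>k \<le> d\<close> by (auto intro!: prod_zero bexI[of _ k])
    qed
    then have "poly L (x k) = (\<Sum>j\<le>d. poly p (x j) * (if j = k then 1 else 0))"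
      unfolding poly_L by (intro sum.cong) auto
    then show ?thesis
      using that by (simp add: if_distrib cong: if_cong)
  qed
  ultimately have "L = p"
    using inj deg by (intro poly_eqI_degree[of "x ` {..d}"]) (auto simp: card_image)
  from poly_L[of y] show ?thesis
    unfolding \<open>L = p\<close> .
qed

lemma poly_chebyshev_poly: "x \<in> {-1..1} \<Longrightarrow> poly (chebyshev_poly d) x = cos (real d * arccos x)"
  using theI'[OF ex1_chebyshev_poly[of d]] unfolding chebyshev_poly_def by blast

lemma chebyshev_polyI: "(\<And>x. x \<in> {-1..1} \<Longrightarrow> poly p x = cos (real d * arccos x)) \<Longrightarrow> chebyshev_poly d = p"
  unfolding chebyshev_poly_def by (rule the1_equality[OF ex1_chebyshev_poly]) blast

lemma chebyshev_poly_0: "chebyshev_poly 0 = 1"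
  by (rule chebyshev_polyI) simp

lemma chebyshev_poly_1: "chebyshev_poly (Suc 0) = [:0, 1:]"
  by (rule chebyshev_polyI) simp

lemma chebyshev_poly_Suc_Suc:
  "chebyshev_poly (Suc (Suc d)) = [:0, 2:] * chebyshev_poly (Suc d) - chebyshev_poly d"
proof (rule chebyshev_polyI)
  fix x :: real
  assume x: "x \<in> {-1..1}"
  then have "cos (arccos x) = x"
    by simp
  moreover have "cos (real (Suc (Suc d)) * t) = 2 * cos t * cos (real (Suc d) * t) - cos (real d * t)" for t
    using cos_add[of "real (Suc d) * t" t] cos_diff[of "real (Suc d) * t" t]
    by (simp add: algebra_simps)
  moreover have "poly ([:0, 2:] * chebyshev_poly (Suc d) - chebyshev_poly d) x
      = 2 * x * poly (chebyshev_poly (Suc d)) x - poly (chebyshev_poly d) x"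
    by simp
  ultimately show "poly ([:0, 2:] * chebyshev_poly (Suc d) - chebyshev_poly d) x
      = cos (real (Suc (Suc d)) * arccos x)"
    using x by (simp only: poly_chebyshev_poly)
qed

lemma degree_chebyshev_poly_le: "degree (chebyshev_poly d) \<le> d"
proof -
  have "degree (chebyshev_poly d) \<le> d \<and> degree (chebyshev_poly (Suc d)) \<le> Suc d"
  proof (induction d)
    case 0
    then show ?case by (simp add: chebyshev_poly_0 chebyshev_poly_1)
  next
    case (Suc d)
    have "degree ([:0, 2:] * chebyshev_poly (Suc d)) \<le> 1 + degree (chebyshev_poly (Suc d))"
      by (rule order_trans[OF degree_mult_le]) simp
    then show ?case
      using Suc unfolding chebyshev_poly_Suc_Suc by (auto intro!: degree_diff_le)
  qed
  then show ?thesis ..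
qed

lemma chebyshev_poly_extremal:
  assumes "0 < d" "j \<le> d"
  shows "poly (chebyshev_poly d) (cos (real j * pi / real d)) = (-1) ^ j"
proof -
  have "0 \<le> real j * pi / real d" "real j * pi / real d \<le> pi"
    using assms by (auto simp: divide_le_eq mult.commute)
  then have "arccos (cos (real j * pi / real d)) = real j * pi / real d"
    by (rule arccos_cos)
  then show ?thesis
    using assms by (subst poly_chebyshev_poly) (auto simp: cos_npi)
qed

lemma chebyshev_extremal_points_decreasing:
  assumes "i < j" "j \<le> d"
  shows "cos (real j * pi / real d) < cos (real i * pi / real d)"
  using assms
  by (intro cos_monotone_0_pi) (auto simp: divide_strict_right_mono divide_le_eq mult.commute)

text \<open>
  Interpolate \<open>T\<^sub>d\<close> at its extremal points. With no node to the right of \<open>X\<close>, no Lagrange basis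
  polynomial has at \<open>X\<close> the sign opposite to that of \<open>T\<^sub>d\<close> at its node, so nothing cancels. In this
  form \<open>T\<^sub>d(X)\<close> can be compared with the interpolation formula of another polynomial factor by factor.
\<close>
lemma chebyshev_poly_eq_sum_abs:
  fixes X :: real
  assumes "0 < d" "1 \<le> X"
  defines "x \<equiv> \<lambda>j. cos (real j * pi / real d)"
  shows "poly (chebyshev_poly d) X = (\<Sum>j\<le>d. \<Prod>i\<in>{..d} - {j}. (X - x i) / \<bar>x j - x i\<bar>)"
proof -
  have anti: "x j < x i" if "i < j" "j \<le> d" for i j
    unfolding x_def using that by (rule chebyshev_extremal_points_decreasing)
  have inj: "inj_on x {..d}"
    by (rule linorder_inj_onI) (auto dest: anti)
  have "poly (chebyshev_poly d) X
      = (\<Sum>j\<le>d. (-1) ^ j * (\<Prod>i\<in>{..d} - {j}. (X - x i) / (x j - x i)))"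
    using chebyshev_poly_extremal[OF \<open>0 < d\<close>]
    by (subst lagrange_interpolation[OF inj degree_chebyshev_poly_le]) (simp add: x_def)
  also have "\<dots> = (\<Sum>j\<le>d. \<Prod>i\<in>{..d} - {j}. (X - x i) / \<bar>x j - x i\<bar>)"
  proof (rule sum.cong[OF refl])
    fix j assume "j \<in> {..d}"
    \<comment> \<open>The nodes decrease, so exactly the \<open>j\<close> factors with \<open>i < j\<close> are negative.\<close>
    have "(\<Prod>i\<in>{..d} - {j}. (X - x i) / \<bar>x j - x i\<bar>)
        = (\<Prod>i\<in>{..d} - {j}. (if i < j then -1 else 1) * ((X - x i) / (x j - x i)))"
    proof (rule prod.cong[OF refl])
      fix i assume "i \<in> {..d} - {j}"
      then show "(X - x i) / \<bar>x j - x i\<bar> = (if i < j then -1 else 1) * ((X - x i) / (x j - x i))"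
        using anti[of i j] anti[of j i] \<open>j \<in> {..d}\<close> by (cases "i < j") (auto simp: abs_if divide_simps algebra_simps)
    qed
    also have "(\<Prod>i\<in>{..d} - {j}. if i < j then -1 else (1::real)) = (-1) ^ j"
    proof -
      have "({..d} - {j}) \<inter> {i. i < j} = {..<j}"
        using \<open>j \<in> {..d}\<close> by auto
      then show ?thesis
        by (simp add: prod.If_cases)
    qed
    then have "(\<Prod>i\<in>{..d} - {j}. (if i < j then -1 else 1) * ((X - x i) / (x j - x i)))
        = (-1) ^ j * (\<Prod>i\<in>{..d} - {j}. (X - x i) / (x j - x i))"
      by (simp only: prod.distrib)
    finally show "(-1) ^ j * (\<Prod>i\<in>{..d} - {j}. (X - x i) / (x j - x i))
        = (\<Prod>i\<in>{..d} - {j}. (X - x i) / \<bar>x j - x i\<bar>)"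
      by simp
  qed
  finally show ?thesis .
qed

section \<open>Remez' inequality in one variable\<close>

text \<open>
  A point of \<open>E\<close> at which the distribution function of \<open>E\<close> takes a prescribed value. The intermediate
  value theorem alone would give a point of the line; choosing the least admissible point of the
  compact set \<open>E\<close> keeps it inside \<open>E\<close>, where the polynomial is bounded.
\<close>
lemma exists_mem_measure_atMost_eq:
  fixes E :: "real set"
  assumes E: "compact E" "E \<noteq> {}" and c: "0 \<le> c" "c \<le> measure lborel E"
  shows "\<exists>t\<in>E. measure lborel (E \<inter> {..t}) = c"
proof -
  define F where "F t = measure lborel (E \<inter> {..t})" for t
  have [simp]: "E \<in> sets borel"
    using E(1) by (rule borel_compact)
  have fm: "E \<inter> A \<in> fmeasurable lborel" if "A \<in> sets borel" for A
    using that E by (intro fmeasurableI2[OF fmeasurable_compact[OF E(1)]]) (auto simp: borel_compact)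
  have mono: "F s \<le> F t" if "s \<le> t" for s t
    unfolding F_def using that fm by (intro measure_mono_fmeasurable) (auto simp: fmeasurableD)
  have lip: "F t - F s \<le> t - s" if "s \<le> t" for s t
  proof -
    have "F t \<le> measure lborel ((E \<inter> {..s}) \<union> {s..t})"
      unfolding F_def using fm
      by (intro measure_mono_fmeasurable fmeasurable.Un fmeasurable_compact[OF compact_Icc]) auto
    also have "\<dots> \<le> F s + measure lborel {s..t}"
      unfolding F_def using fm by (intro measure_Un_le) (auto simp: fmeasurableD)
    finally show ?thesis
      using that by simp
  qed
  have cont: "continuous_on UNIV F"
  proof (rule lipschitz_on_continuous_on[of 1], rule lipschitz_onI)
    fix s t
    show "dist (F s) (F t) \<le> 1 * dist s t"
      using lip[of s t] lip[of t s] mono[of s t] mono[of t s] by (auto simp: dist_real_def abs_if)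
  qed simp
  have bdd: "bdd_above E" "bdd_below E"
    using E by (auto simp: compact_imp_bounded bounded_imp_bdd_above bounded_imp_bdd_below)
  have F_Sup: "F (Sup E) = measure lborel E"
  proof -
    have "E \<inter> {..Sup E} = E"
      using bdd by (auto intro: cSup_upper)
    then show ?thesis by (simp add: F_def)
  qed
  \<comment> \<open>The least point of \<open>E\<close> at which \<open>F\<close> has reached \<open>c\<close> is the point sought.\<close>
  define A where "A = E \<inter> {t. c \<le> F t}"
  have "closed {t. c \<le> F t}"
    using cont by (intro closed_Collect_le) auto
  then have "compact A"
    unfolding A_def using E by blast
  moreover have "Sup E \<in> A"
    unfolding A_def using c F_Sup closed_contains_Sup[OF E(2) bdd(1) compact_imp_closed[OF E(1)]] by simp
  ultimately obtain t where t: "t \<in> A" and t_min: "\<And>e. e \<in> A \<Longrightarrow> t \<le> e"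
    using compact_attains_inf[of A] by auto
  have "F t \<le> c"
  proof (rule ccontr)
    assume "\<not> F t \<le> c"
    define u where "u = Inf E - 1"
    have below: "u < e" if "e \<in> E" for e
      unfolding u_def using cInf_lower[OF that bdd(2)] by simp
    then have "E \<inter> {..u} = {}" by force
    then have "F u = 0" by (simp add: F_def)
    moreover have "u \<le> t"
      using below t by (force simp: A_def)
    ultimately obtain t' where t': "t' \<le> t" "F t' = (c + F t) / 2"
      using IVT'[of F u "(c + F t) / 2" t] c \<open>\<not> F t \<le> c\<close> continuous_on_subset[OF cont] by auto
    \<comment> \<open>\<open>F\<close> still grows between \<open>t'\<close> and \<open>t\<close>, so \<open>E\<close> has a point there, against the minimality of \<open>t\<close>.\<close>
    have "E \<inter> {t'<..<t} \<noteq> {}"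
    proof
      assume "E \<inter> {t'<..<t} = {}"
      then have "E \<inter> {..t} \<subseteq> (E \<inter> {..t'}) \<union> {t}"
        by force
      then have "F t \<le> measure lborel ((E \<inter> {..t'}) \<union> {t})"
        unfolding F_def using fm
        by (intro measure_mono_fmeasurable fmeasurable.Un fmeasurable_compact[of "{t}"]) (auto simp: fmeasurableD)
      also have "\<dots> \<le> F t' + measure lborel {t}"
        unfolding F_def using fm by (intro measure_Un_le) (auto simp: fmeasurableD)
      finally show False
        using t' \<open>\<not> F t \<le> c\<close> by simp
    qed
    then obtain e where e: "e \<in> E" "t' < e" "e < t" by auto
    then have "e \<in> A"
      using mono[of t' e] t' \<open>\<not> F t \<le> c\<close> by (simp add: A_def)
    then show False
      using t_min e by force
  qed
  then show ?thesis
    using t unfolding A_def F_def by force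
qed

lemma compact_sublevel_poly: "compact {x \<in> {a..b}. \<bar>poly p x\<bar> \<le> (r::real)}"
proof -
  have "closed {x. \<bar>poly p x\<bar> \<le> r}"
    by (intro closed_Collect_le continuous_intros)
  then have "compact ({a..b} \<inter> {x. \<bar>poly p x\<bar> \<le> r})"
    by blast
  then show ?thesis
    by (simp add: Int_def)
qed

text \<open>
  Choose \<open>t\<^sub>j \<in> E\<close> so that \<open>E\<close> has measure \<open>1 + x\<^sub>j\<close> to the left of \<open>t\<^sub>j\<close>, where
  \<open>x\<^sub>j = cos (j\<pi>/d)\<close>; on the set \<open>[-1,1]\<close> this would give back \<open>t\<^sub>j = x\<^sub>j\<close>. Gaps in \<open>E\<close> can
  only move the points to the right, closer to \<open>X\<close>, and further apart from each other. Hence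
  each factor \<open>(X - t\<^sub>i) / |t\<^sub>j - t\<^sub>i|\<close> in Lagrange's formula for \<open>p(X)\<close> is at most the corresponding
  factor in the formula for \<open>T\<^sub>d(X)\<close>. For the present purpose the value at the endpoint is
  enough, because each ray starts at the point where the polynomial is to be estimated.
\<close>
theorem remez_inequality_endpoint:
  fixes p :: "real poly"
  assumes "0 < d" and deg: "degree p \<le> d" and "1 \<le> X"
    and meas: "2 \<le> measure lborel {x \<in> {-1..X}. \<bar>poly p x\<bar> \<le> 1}"
  shows "\<bar>poly p X\<bar> \<le> poly (chebyshev_poly d) X"
proof -
  define E where "E = {x \<in> {-1..X}. \<bar>poly p x\<bar> \<le> 1}"
  have E: "compact E"
    unfolding E_def by (rule compact_sublevel_poly)
  have "E \<noteq> {}"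
    using meas unfolding E_def[symmetric] by auto
  have [simp]: "E \<in> sets borel"
    using E by (rule borel_compact)
  have fm: "E \<inter> {..s} \<in> fmeasurable lborel" for s
    using E by (intro fmeasurableI2[OF fmeasurable_compact[OF E(1)]]) (auto simp: borel_compact)
  define x where "x j = cos (real j * pi / real d)" for j
  have "\<exists>t\<in>E. measure lborel (E \<inter> {..t}) = 1 + x j" for j
  proof (rule exists_mem_measure_atMost_eq[OF E \<open>E \<noteq> {}\<close>])
    have "-1 \<le> x j" "x j \<le> 1"
      by (simp_all add: x_def)
    then show "0 \<le> 1 + x j" "1 + x j \<le> measure lborel E"
      using meas unfolding E_def[symmetric] by linarith+
  qed
  then obtain t where t: "t j \<in> E" "measure lborel (E \<inter> {..t j}) = 1 + x j" for j
    by metis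
  have right: "x j \<le> t j" for j
  proof -
    have "E \<inter> {..t j} \<subseteq> {-1..t j}"
      by (auto simp: E_def)
    then have "measure lborel (E \<inter> {..t j}) \<le> measure lborel {-1..t j}"
      using fm by (intro measure_mono_fmeasurable fmeasurable_compact[OF compact_Icc]) auto
    then show ?thesis
      using t[of j] by (simp add: E_def)
  qed
  have apart: "x i - x j \<le> \<bar>t i - t j\<bar>" for i j
  proof (cases "t j \<le> t i")
    case True
    have "measure lborel (E \<inter> {..t i}) \<le> measure lborel ((E \<inter> {..t j}) \<union> {t j..t i})"
      using fm by (intro measure_mono_fmeasurable fmeasurable.Un fmeasurable_compact[OF compact_Icc]) (auto simp: fmeasurableD)
    also have "\<dots> \<le> measure lborel (E \<inter> {..t j}) + measure lborel {t j..t i}"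
      using fm by (intro measure_Un_le) (auto simp: fmeasurableD)
    finally show ?thesis
      using t(2)[of i] t(2)[of j] True by simp
  next
    case False
    then have "measure lborel (E \<inter> {..t i}) \<le> measure lborel (E \<inter> {..t j})"
      using fm by (intro measure_mono_fmeasurable) (auto simp: fmeasurableD)
    then show ?thesis
      using t(2)[of i] t(2)[of j] by simp
  qed
  have anti: "x j < x i" if "i < j" "j \<le> d" for i j
    unfolding x_def using that by (rule chebyshev_extremal_points_decreasing)
  have x_apart: "0 < \<bar>x j - x i\<bar>" if "i \<le> d" "j \<le> d" "i \<noteq> j" for i j
    using anti[of i j] anti[of j i] that by (cases "i < j") auto
  have abs_apart: "\<bar>x j - x i\<bar> \<le> \<bar>t j - t i\<bar>" for i j
    using apart[of i j] apart[of j i] by linarith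
  have inj: "inj_on t {..d}"
  proof (rule inj_onI, rule ccontr)
    fix i j assume "i \<in> {..d}" "j \<in> {..d}" "t i = t j" "i \<noteq> j"
    then show False
      using x_apart[of i j] abs_apart[of j i] by simp
  qed
  have "\<bar>poly p X\<bar> = \<bar>\<Sum>j\<le>d. poly p (t j) * (\<Prod>i\<in>{..d} - {j}. (X - t i) / (t j - t i))\<bar>"
    by (subst lagrange_interpolation[OF inj deg]) simp
  also have "\<dots> \<le> (\<Sum>j\<le>d. \<bar>poly p (t j)\<bar> * \<bar>\<Prod>i\<in>{..d} - {j}. (X - t i) / (t j - t i)\<bar>)"
    using sum_abs by (simp only: abs_mult[symmetric])
  also have "\<dots> \<le> (\<Sum>j\<le>d. \<Prod>i\<in>{..d} - {j}. (X - x i) / \<bar>x j - x i\<bar>)"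
  proof (rule sum_mono)
    fix j assume j: "j \<in> {..d}"
    have "\<bar>\<Prod>i\<in>{..d} - {j}. (X - t i) / (t j - t i)\<bar> \<le> (\<Prod>i\<in>{..d} - {j}. (X - x i) / \<bar>x j - x i\<bar>)"
      unfolding abs_prod
    proof (rule prod_mono)
      fix i assume i: "i \<in> {..d} - {j}"
      have "\<bar>X - t i\<bar> \<le> X - x i"
        using t(1)[of i] right[of i] by (simp add: E_def)
      then show "0 \<le> \<bar>(X - t i) / (t j - t i)\<bar> \<and> \<bar>(X - t i) / (t j - t i)\<bar> \<le> (X - x i) / \<bar>x j - x i\<bar>"
        using i j x_apart[of i j] abs_apart[of j i] by (auto simp: abs_divide intro!: frac_le)
    qed
    moreover have "\<bar>poly p (t j)\<bar> \<le> 1"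
      using t(1)[of j] by (simp add: E_def)
    ultimately show "\<bar>poly p (t j)\<bar> * \<bar>\<Prod>i\<in>{..d} - {j}. (X - t i) / (t j - t i)\<bar>
        \<le> (\<Prod>i\<in>{..d} - {j}. (X - x i) / \<bar>x j - x i\<bar>)"
      using mult_left_le_one_le[of "\<bar>\<Prod>i\<in>{..d} - {j}. (X - t i) / (t j - t i)\<bar>" "\<bar>poly p (t j)\<bar>"]
      by linarith
  qed
  also have "\<dots> = poly (chebyshev_poly d) X"
    using chebyshev_poly_eq_sum_abs[OF \<open>0 < d\<close> \<open>1 \<le> X\<close>] by (simp add: x_def)
  finally show ?thesis .
qed

corollary remez_inequality_at_0:
  fixes p :: "real poly"
  assumes "0 < d" and deg: "degree p \<le> d" and "0 < R" "0 < \<theta>" "\<theta> \<le> 1"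
    and meas: "\<theta> * R \<le> measure lborel {s \<in> {0..R}. \<bar>poly p s\<bar> \<le> 1}"
  shows "\<bar>poly p 0\<bar> \<le> poly (chebyshev_poly d) (2 / \<theta> - 1)"
proof -
  \<comment> \<open>The affine map \<open>x \<mapsto> h (X - x)\<close> takes \<open>[-1, X]\<close> to \<open>[0, R]\<close>, \<open>X\<close> to \<open>0\<close>, and measure \<open>2\<close> to measure
    \<open>\<theta> R\<close>.\<close>
  define X where "X = 2 / \<theta> - 1"
  define h where "h = \<theta> * R / 2"
  define q where "q = pcompose p [:h * X, - h:]"
  define E where "E = {x \<in> {-1..X}. \<bar>poly q x\<bar> \<le> 1}"
  have "0 < h" and hX: "h * X + h = R" and "1 \<le> X"
    using assms by (simp_all add: h_def X_def field_simps)
  have poly_q: "poly q x = poly p (h * X + (- h) * x)" for x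
    by (simp add: q_def poly_pcompose algebra_simps)
  have "{s \<in> {0..R}. \<bar>poly p s\<bar> \<le> 1} = (\<lambda>x. h * X + (- h) *\<^sub>R x) ` E"
  proof (intro equalityI subsetI)
    fix s assume s: "s \<in> {s \<in> {0..R}. \<bar>poly p s\<bar> \<le> 1}"
    have "s = h * X + (- h) *\<^sub>R (X - s / h)"
      using \<open>0 < h\<close> by (simp add: algebra_simps)
    moreover have "X - s / h \<in> E"
    proof -
      have "s / h \<le> X + 1"
        using s hX \<open>0 < h\<close> by (simp add: divide_le_eq algebra_simps)
      then show ?thesis
        using s \<open>0 < h\<close> by (auto simp: E_def poly_q algebra_simps)
    qed
    ultimately show "s \<in> (\<lambda>x. h * X + (- h) *\<^sub>R x) ` E"
      by (rule image_eqI)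
  next
    fix s assume "s \<in> (\<lambda>x. h * X + (- h) *\<^sub>R x) ` E"
    then obtain x where x: "x \<in> E" "s = h * X + (- h) * x"
      by auto
    have "h * x \<le> h * X" "- h \<le> h * x"
      using x \<open>0 < h\<close> mult_left_mono[of x X h] mult_left_mono[of "-1" x h] by (auto simp: E_def)
    then show "s \<in> {s \<in> {0..R}. \<bar>poly p s\<bar> \<le> 1}"
      using x hX by (auto simp: E_def poly_q)
  qed
  then have "measure lebesgue {s \<in> {0..R}. \<bar>poly p s\<bar> \<le> 1} = h * measure lebesgue E"
    using measure_lebesgue_affine[of "- h" "h * X" E] \<open>0 < h\<close> by simp
  moreover have "{s \<in> {0..R}. \<bar>poly p s\<bar> \<le> 1} \<in> sets borel" "E \<in> sets borel"
    unfolding E_def by (simp_all only: borel_compact[OF compact_sublevel_poly])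
  ultimately have "measure lborel {s \<in> {0..R}. \<bar>poly p s\<bar> \<le> 1} = h * measure lborel E"
    by (simp add: measure_completion)
  then have "h * 2 \<le> h * measure lborel E"
    using meas by (simp add: h_def)
  then have "2 \<le> measure lborel E"
    using \<open>0 < h\<close> by simp
  moreover have "degree q \<le> d"
    unfolding q_def using deg degree_pcompose_le[of p "[:h * X, - h:]"] \<open>0 < h\<close> by simp
  ultimately have "\<bar>poly q X\<bar> \<le> poly (chebyshev_poly d) X"
    using \<open>0 < d\<close> \<open>1 \<le> X\<close> unfolding E_def by (intro remez_inequality_endpoint)
  then show ?thesis
    by (simp add: poly_q X_def)
qed

section \<open>Comparing integrals along rays\<close>

lemma nn_integral_lborel_scaleR:
  fixes f :: "'a::euclidean_space \<Rightarrow> ennreal"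
  assumes [measurable]: "f \<in> borel_measurable borel" and "0 < s"
  shows "(\<integral>\<^sup>+x. f x \<partial>lborel) = (\<integral>\<^sup>+x. ennreal (s ^ DIM('a)) * f (s *\<^sub>R x) \<partial>lborel)"
  using assms(2)
  by (subst lborel_affine[of s 0]) (auto simp: nn_integral_density nn_integral_distr nn_integral_cmult)

text \<open>
  Integration in polar coordinates, with the sphere replaced by the annulus \<open>A\<close>. Each ray meets \<open>A\<close> in
  a segment instead of a point, so a point \<open>y\<close> is reached as \<open>s x\<close> with \<open>x \<in> A\<close> for all \<open>s\<close> between
  \<open>|y|/2\<close> and \<open>|y|\<close>; the logarithmic length of this range is the constant \<open>ln 2\<close>. In place
  of a surface measure, only Tonelli's theorem and the scaling of Lebesgue measure enter.
\<close>
lemma nn_integral_over_rays: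
  fixes h :: "'a::euclidean_space \<Rightarrow> ennreal"
  assumes h[measurable]: "h \<in> borel_measurable borel"
  defines "A \<equiv> {x :: 'a. 1 \<le> norm x \<and> norm x \<le> 2}"
  shows "(\<integral>\<^sup>+x. indicator A x *
            (\<integral>\<^sup>+s. ennreal (s ^ (DIM('a) - 1)) * h (s *\<^sub>R x) * indicator {0<..} s \<partial>lborel) \<partial>lborel)
       = ennreal (ln 2) * (\<integral>\<^sup>+x. h x \<partial>lborel)"
proof -
  have [measurable]: "A \<in> sets borel"
    unfolding A_def by measurable
  have radial: "(\<integral>\<^sup>+s. ennreal (1 / s) * indicator A (y /\<^sub>R s) * indicator {0<..} s \<partial>lborel) = ennreal (ln 2)"
    if "y \<noteq> 0" for y :: 'a
  proof -
    define r where "r = norm y"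
    have "0 < r" using that by (simp add: r_def)
    have "ennreal (1 / s) * indicator A (y /\<^sub>R s) * indicator {0<..} s
        = ennreal (if 0 < s then 1 / s else 0) * indicator {r / 2..r} s" for s :: real
      using \<open>0 < r\<close> by (auto simp: A_def r_def indicator_def field_simps)
    then have "(\<integral>\<^sup>+s. ennreal (1 / s) * indicator A (y /\<^sub>R s) * indicator {0<..} s \<partial>lborel)
        = (\<integral>\<^sup>+s. ennreal (if 0 < s then 1 / s else 0) * indicator {r / 2..r} s \<partial>lborel)"
      by simp
    also have "\<dots> = ennreal (ln r - ln (r / 2))"
      using \<open>0 < r\<close> by (intro nn_integral_FTC_Icc) (auto intro!: derivative_eq_intros)
    also have "ln r - ln (r / 2) = ln 2"
      using \<open>0 < r\<close> by (simp add: ln_div)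
    finally show ?thesis .
  qed
  have "(\<integral>\<^sup>+x. indicator A x *
            (\<integral>\<^sup>+s. ennreal (s ^ (DIM('a) - 1)) * h (s *\<^sub>R x) * indicator {0<..} s \<partial>lborel) \<partial>lborel)
      = (\<integral>\<^sup>+x. \<integral>\<^sup>+s. indicator A x *
            (ennreal (s ^ (DIM('a) - 1)) * h (s *\<^sub>R x) * indicator {0<..} s) \<partial>lborel \<partial>lborel)"
    by (simp add: nn_integral_cmult)
  also have "\<dots> = (\<integral>\<^sup>+s. \<integral>\<^sup>+x. indicator A x *
            (ennreal (s ^ (DIM('a) - 1)) * h (s *\<^sub>R x) * indicator {0<..} s) \<partial>lborel \<partial>lborel)"
    by (rule lborel_pair.Fubini'[symmetric]) simp
  also have "\<dots> = (\<integral>\<^sup>+s. \<integral>\<^sup>+y. h y * (ennreal (1 / s) * indicator A (y /\<^sub>R s) * indicator {0<..} s) \<partial>lborel \<partial>lborel)"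
  proof (rule nn_integral_cong)
    fix s :: real
    show "(\<integral>\<^sup>+x. indicator A x * (ennreal (s ^ (DIM('a) - 1)) * h (s *\<^sub>R x) * indicator {0<..} s) \<partial>lborel)
        = (\<integral>\<^sup>+y. h y * (ennreal (1 / s) * indicator A (y /\<^sub>R s) * indicator {0<..} s) \<partial>lborel)"
    proof (cases "0 < s")
      case True
      then have "s ^ (DIM('a) - 1) = s ^ DIM('a) * (1 / s)"
        by (simp add: power_diff)
      then have pow: "ennreal (s ^ (DIM('a) - 1)) = ennreal (s ^ DIM('a)) * ennreal (1 / s)"
        using True by (simp add: ennreal_mult[symmetric] del: ennreal_mult)
      show ?thesis
        using True
        by (subst nn_integral_lborel_scaleR[OF _ True, of "\<lambda>y. h y * (ennreal (1 / s) * indicator A (y /\<^sub>R s) * indicator {0<..} s)"])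
           (auto simp: pow[unfolded One_nat_def] mult_ac)
    qed simp
  qed
  also have "\<dots> = (\<integral>\<^sup>+y. \<integral>\<^sup>+s. h y * (ennreal (1 / s) * indicator A (y /\<^sub>R s) * indicator {0<..} s) \<partial>lborel \<partial>lborel)"
    by (rule lborel_pair.Fubini') simp
  also have "\<dots> = (\<integral>\<^sup>+y. h y * (\<integral>\<^sup>+s. ennreal (1 / s) * indicator A (y /\<^sub>R s) * indicator {0<..} s \<partial>lborel) \<partial>lborel)"
    by (simp add: nn_integral_cmult)
  also have "\<dots> = (\<integral>\<^sup>+y. h y * ennreal (ln 2) \<partial>lborel)"
    using AE_lborel_singleton[of "0 :: 'a"] by (intro nn_integral_cong_AE) (auto simp: radial)
  finally show ?thesis
    by (simp add: nn_integral_multc mult.commute)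
qed

lemma mult_left_mono_indicator:
  fixes a b :: ennreal
  shows "(x \<in> A \<Longrightarrow> a \<le> b) \<Longrightarrow> indicator A x * a \<le> indicator A x * b"
  by (simp add: indicator_def)

lemma nn_integral_mono_on_rays:
  fixes f g :: "'a::euclidean_space \<Rightarrow> ennreal"
  assumes [measurable]: "f \<in> borel_measurable borel" "g \<in> borel_measurable borel"
    and rays: "\<And>v. v \<noteq> 0 \<Longrightarrow>
      (\<integral>\<^sup>+s. ennreal (s ^ (DIM('a) - 1)) * f (s *\<^sub>R v) * indicator {0<..} s \<partial>lborel)
      \<le> (\<integral>\<^sup>+s. ennreal (s ^ (DIM('a) - 1)) * g (s *\<^sub>R v) * indicator {0<..} s \<partial>lborel)"
  shows "(\<integral>\<^sup>+x. f x \<partial>lborel) \<le> (\<integral>\<^sup>+x. g x \<partial>lborel)"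
proof -
  have "ennreal (ln 2) * (\<integral>\<^sup>+x. f x \<partial>lborel) \<le> ennreal (ln 2) * (\<integral>\<^sup>+x. g x \<partial>lborel)"
    unfolding nn_integral_over_rays[OF assms(1), symmetric] nn_integral_over_rays[OF assms(2), symmetric]
  proof (rule nn_integral_mono, rule mult_left_mono_indicator)
    fix x :: 'a
    assume "x \<in> {x. 1 \<le> norm x \<and> norm x \<le> 2}"
    then have "x \<noteq> 0" by auto
    then show "(\<integral>\<^sup>+s. ennreal (s ^ (DIM('a) - 1)) * f (s *\<^sub>R x) * indicator {0<..} s \<partial>lborel)
        \<le> (\<integral>\<^sup>+s. ennreal (s ^ (DIM('a) - 1)) * g (s *\<^sub>R x) * indicator {0<..} s \<partial>lborel)"
      by (rule rays)
  qed
  then show ?thesis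
    by (simp add: ennreal_mult_le_mult_iff)
qed

text \<open>
  Among the sets of given measure in the half-line, the initial segment minimises the integral of a
  nondecreasing weight: exchanging \<open>{0..m} - W\<close> for \<open>W - {0..m}\<close> does not lose measure and moves it
  across \<open>m\<close>, to where the weight is larger.
\<close>
lemma nn_integral_initial_segment_le:
  fixes w :: "real \<Rightarrow> ennreal"
  assumes [measurable]: "w \<in> borel_measurable borel" "W \<in> sets borel"
    and mono: "\<And>s t. 0 \<le> s \<Longrightarrow> s \<le> t \<Longrightarrow> w s \<le> w t"
    and W: "W \<subseteq> {0..}" "ennreal m \<le> emeasure lborel W" and "0 \<le> m"
  shows "(\<integral>\<^sup>+s. w s * indicator {0..m} s \<partial>lborel) \<le> (\<integral>\<^sup>+s. w s * indicator W s \<partial>lborel)"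
proof -
  have split: "(\<integral>\<^sup>+s. u s * indicator A s \<partial>lborel)
      = (\<integral>\<^sup>+s. u s * indicator (A \<inter> B) s \<partial>lborel) + (\<integral>\<^sup>+s. u s * indicator (A - B) s \<partial>lborel)"
    if [measurable]: "A \<in> sets borel" "B \<in> sets borel" "u \<in> borel_measurable borel"
    for A B :: "real set" and u :: "real \<Rightarrow> ennreal"
    by (subst nn_integral_add[symmetric]) (auto intro!: nn_integral_cong simp: indicator_def)
  have "emeasure lborel ({0..m} \<inter> W) + emeasure lborel ({0..m} - W)
      \<le> emeasure lborel ({0..m} \<inter> W) + emeasure lborel (W - {0..m})"
    using split[of "{0..m}" W "\<lambda>_. 1"] split[of W "{0..m}" "\<lambda>_. 1"] W \<open>0 \<le> m\<close>
    by (simp add: Int_commute)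
  moreover have "emeasure lborel ({0..m} \<inter> W) \<noteq> \<infinity>"
    using emeasure_mono[of "{0..m} \<inter> W" "{0..m}" lborel] \<open>0 \<le> m\<close> by (auto simp: top_unique)
  ultimately have swap: "emeasure lborel ({0..m} - W) \<le> emeasure lborel (W - {0..m})"
    by (simp add: ennreal_add_left_cancel_le)
  have "(\<integral>\<^sup>+s. w s * indicator ({0..m} - W) s \<partial>lborel) \<le> (\<integral>\<^sup>+s. w m * indicator ({0..m} - W) s \<partial>lborel)"
    by (intro nn_integral_mono) (auto simp: indicator_def intro!: mono)
  also have "\<dots> = w m * emeasure lborel ({0..m} - W)"
    by (simp add: nn_integral_cmult)
  also have "\<dots> \<le> w m * emeasure lborel (W - {0..m})"
    using swap by (rule mult_left_mono) simp
  also have "\<dots> = (\<integral>\<^sup>+s. w m * indicator (W - {0..m}) s \<partial>lborel)"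
    by (simp add: nn_integral_cmult)
  also have "\<dots> \<le> (\<integral>\<^sup>+s. w s * indicator (W - {0..m}) s \<partial>lborel)"
    using W \<open>0 \<le> m\<close> by (intro nn_integral_mono) (auto simp: indicator_def intro!: mono)
  finally show ?thesis
    using split[of "{0..m}" W w] split[of W "{0..m}" w] by (simp add: Int_commute add_left_mono)
qed

lemma ray_section_eq_interval:
  fixes K :: "'a::euclidean_space set"
  assumes "compact K" "convex K" "0 \<in> K" "v \<noteq> 0"
  shows "\<exists>R\<ge>0. {s. 0 \<le> s \<and> s *\<^sub>R v \<in> K} = {0..R}"
proof -
  define S where "S = {s. 0 \<le> s \<and> s *\<^sub>R v \<in> K}"
  obtain B where B: "norm x \<le> B" if "x \<in> K" for x
    using compact_imp_bounded[OF assms(1)] by (auto simp: bounded_iff)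
  have "s \<le> B / norm v" if "s \<in> S" for s
    using B[of "s *\<^sub>R v"] that \<open>v \<noteq> 0\<close> by (simp add: S_def field_simps)
  then have bdd: "bdd_above S"
    by (rule bdd_aboveI)
  have "0 \<in> S"
    using assms by (simp add: S_def)
  have "closed ((\<lambda>s. s *\<^sub>R v) -` K)"
    by (intro closed_vimage compact_imp_closed continuous_intros assms(1))
  moreover have "S = {0..} \<inter> (\<lambda>s. s *\<^sub>R v) -` K"
    by (auto simp: S_def)
  ultimately have "closed S"
    by (simp add: closed_Int)
  then have Sup: "Sup S \<in> S"
    using \<open>0 \<in> S\<close> bdd by (intro closed_contains_Sup) auto
  have "s \<in> S" if s: "0 \<le> s" "s \<le> Sup S" for s
  proof (cases "Sup S = 0")
    case True
    then show ?thesis using s \<open>0 \<in> S\<close> by simp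
  next
    case False
    then have "(1 - s / Sup S) *\<^sub>R 0 + (s / Sup S) *\<^sub>R (Sup S *\<^sub>R v) \<in> K"
      using s Sup assms by (intro convexD) (auto simp: S_def divide_le_eq)
    then show ?thesis
      using False s by (simp add: S_def)
  qed
  then have "S = {0..Sup S}"
    using cSup_upper[OF _ bdd] by (auto simp: S_def)
  moreover have "0 \<le> Sup S"
    using Sup by (simp add: S_def)
  ultimately show ?thesis
    unfolding S_def[symmetric] by blast
qed

section \<open>The inequality of Brudnyi and Ganzburg\<close>

text \<open>
  The ray through \<open>v\<close> meets \<open>K\<close> in a segment \<open>[0, R]\<close>. By the one-dimensional Remez inequality, the set
  where \<open>|P| \<le> 1\<close> occupies less than the fraction \<open>1 - \<sigma>\<close> of it, since otherwise \<open>P\<close> could not be that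
  large at the starting point. The set where \<open>|P| > 1\<close> thus has length at least \<open>\<sigma> R\<close>, which is
  the length in the shrunken body \<open>\<sigma> K\<close>, and the latter sits at the beginning of the ray, where the
  weight is smallest.
\<close>
lemma ray_comparison_of_large_value:
  fixes K :: "'a::euclidean_space set" and P :: "'a \<Rightarrow> real"
  assumes "0 < d" and K: "compact K" "convex K" "0 \<in> K"
    and ray: "degree q \<le> d" "\<And>s. P (s *\<^sub>R v) = poly q s" and "v \<noteq> 0"
    and \<sigma>: "0 < \<sigma>" "\<sigma> < 1" and large: "poly (chebyshev_poly d) ((1 + \<sigma>) / (1 - \<sigma>)) < \<bar>P 0\<bar>"
  shows "(\<integral>\<^sup>+s. ennreal (s ^ k) * indicator ((*\<^sub>R) \<sigma> ` K) (s *\<^sub>R v) * indicator {0<..} s \<partial>lborel)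
      \<le> (\<integral>\<^sup>+s. ennreal (s ^ k) * indicator {x \<in> K. 1 < \<bar>P x\<bar>} (s *\<^sub>R v) * indicator {0<..} s \<partial>lborel)"
proof -
  obtain R where R: "0 \<le> R" "{s. 0 \<le> s \<and> s *\<^sub>R v \<in> K} = {0..R}"
    using ray_section_eq_interval[OF K \<open>v \<noteq> 0\<close>] by blast
  then have in_K: "s *\<^sub>R v \<in> K \<longleftrightarrow> s \<le> R" if "0 < s" for s
  proof -
    have "s \<in> {s. 0 \<le> s \<and> s *\<^sub>R v \<in> K} \<longleftrightarrow> s \<in> {0..R}"
      by (simp only: R(2))
    then show ?thesis
      using that by simp
  qed
  define W where "W = {s \<in> {0<..R}. 1 < \<bar>poly q s\<bar>}"
  define E where "E = {s \<in> {0..R}. \<bar>poly q s\<bar> \<le> 1}"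
  have "{s. 1 < \<bar>poly q s\<bar>} \<in> sets borel"
    by (intro borel_open open_Collect_less continuous_intros)
  then have "{0<..R} \<inter> {s. 1 < \<bar>poly q s\<bar>} \<in> sets borel"
    by (rule sets.Int[rotated]) simp
  moreover have "W = {0<..R} \<inter> {s. 1 < \<bar>poly q s\<bar>}"
    by (auto simp: W_def)
  ultimately have W: "W \<in> sets borel"
    by simp
  have W_fm: "W \<in> fmeasurable lborel"
    by (rule fmeasurableI2[OF fmeasurable_compact[OF compact_Icc[of 0 R]]]) (use W in \<open>auto simp: W_def\<close>)
  have E_fm: "E \<in> fmeasurable lborel"
    unfolding E_def by (rule fmeasurable_compact[OF compact_sublevel_poly])
  have "\<sigma> * R \<le> measure lborel W"
  proof (cases "R = 0")
    case False
    have "\<not> (1 - \<sigma>) * R \<le> measure lborel E"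
    proof
      assume "(1 - \<sigma>) * R \<le> measure lborel E"
      then have "\<bar>poly q 0\<bar> \<le> poly (chebyshev_poly d) (2 / (1 - \<sigma>) - 1)"
        using \<open>0 < d\<close> ray(1) R(1) False \<sigma> unfolding E_def by (intro remez_inequality_at_0) auto
      moreover have "2 / (1 - \<sigma>) - 1 = (1 + \<sigma>) / (1 - \<sigma>)"
        using \<sigma> by (simp add: field_simps)
      ultimately show False
        using large ray(2)[of 0] by simp
    qed
    moreover have "R \<le> measure lborel E + measure lborel W"
    proof -
      have "{0..R} \<subseteq> {0} \<union> (E \<union> W)"
        by (auto simp: E_def W_def)
      then have "measure lborel {0..R} \<le> measure lborel ({0} \<union> (E \<union> W))"
        using W_fm E_fm by (intro measure_mono_fmeasurable fmeasurable.Un fmeasurable_compact[of "{0}"]) auto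
      also have "\<dots> \<le> measure lborel {0::real} + measure lborel (E \<union> W)"
        using fmeasurableD[OF fmeasurable.Un[OF E_fm W_fm]] by (intro measure_Un_le) auto
      also have "\<dots> \<le> measure lborel {0::real} + (measure lborel E + measure lborel W)"
        using W_fm E_fm by (intro add_left_mono measure_Un_le) (auto simp: fmeasurableD)
      finally show ?thesis
        using R(1) by simp
    qed
    ultimately show ?thesis
      by (simp add: algebra_simps)
  qed simp
  then have W_ge: "ennreal (\<sigma> * R) \<le> emeasure lborel W"
    using W_fm by (simp add: emeasure_eq_measure2 ennreal_leI)
  have "(\<integral>\<^sup>+s. ennreal (s ^ k) * indicator ((*\<^sub>R) \<sigma> ` K) (s *\<^sub>R v) * indicator {0<..} s \<partial>lborel)
      \<le> (\<integral>\<^sup>+s. ennreal (s ^ k) * indicator {0..\<sigma> * R} s \<partial>lborel)"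
  proof (rule nn_integral_mono)
    fix s :: real
    have "s \<le> \<sigma> * R" if s: "0 < s" and x: "x \<in> K" "s *\<^sub>R v = \<sigma> *\<^sub>R x" for x
    proof -
      have "(s / \<sigma>) *\<^sub>R v = (1 / \<sigma>) *\<^sub>R (s *\<^sub>R v)"
        by simp
      also have "\<dots> = x"
        using x(2) \<sigma>(1) by simp
      finally have "s / \<sigma> \<le> R"
        using in_K[of "s / \<sigma>"] x s \<sigma> by simp
      then show ?thesis
        using \<sigma> by (simp add: divide_le_eq mult.commute)
    qed
    then show "ennreal (s ^ k) * indicator ((*\<^sub>R) \<sigma> ` K) (s *\<^sub>R v) * indicator {0<..} s
        \<le> ennreal (s ^ k) * indicator {0..\<sigma> * R} s"
      by (auto simp: indicator_def)
  qed
  also have "\<dots> \<le> (\<integral>\<^sup>+s. ennreal (s ^ k) * indicator W s \<partial>lborel)"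
    using W W_ge R(1) \<sigma>
    by (intro nn_integral_initial_segment_le) (auto simp: W_def intro!: ennreal_leI power_mono)
  also have "\<dots> \<le> (\<integral>\<^sup>+s. ennreal (s ^ k) * indicator {x \<in> K. 1 < \<bar>P x\<bar>} (s *\<^sub>R v) * indicator {0<..} s \<partial>lborel)"
    using in_K ray(2) by (intro nn_integral_mono) (auto simp: indicator_def W_def)
  finally show ?thesis .
qed

lemma measure_superlevel_ge_of_large_value:
  fixes K :: "'a::euclidean_space set" and P :: "'a \<Rightarrow> real"
  assumes "0 < d" and K: "compact K" "convex K" "0 \<in> K" and P: "continuous_on UNIV P"
    and ray: "\<And>v. \<exists>q. degree q \<le> d \<and> (\<forall>s. P (s *\<^sub>R v) = poly q s)"
    and \<sigma>: "0 < \<sigma>" "\<sigma> < 1" and large: "poly (chebyshev_poly d) ((1 + \<sigma>) / (1 - \<sigma>)) < \<bar>P 0\<bar>"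
  shows "\<sigma> ^ DIM('a) * measure lebesgue K \<le> measure lebesgue {x \<in> K. 1 < \<bar>P x\<bar>}"
proof -
  have "compact ((*\<^sub>R) \<sigma> ` K)"
    using K(1) by (rule compact_scaling)
  then have \<sigma>K: "(*\<^sub>R) \<sigma> ` K \<in> sets borel" "(*\<^sub>R) \<sigma> ` K \<in> fmeasurable lborel"
    by (auto intro: borel_compact fmeasurable_compact)
  have "{x. 1 < \<bar>P x\<bar>} \<in> sets borel"
    using P by (intro borel_open open_Collect_less continuous_intros)
  moreover have "{x \<in> K. 1 < \<bar>P x\<bar>} = K \<inter> {x. 1 < \<bar>P x\<bar>}"
    by auto
  ultimately have W: "{x \<in> K. 1 < \<bar>P x\<bar>} \<in> sets borel"
    using borel_compact[OF K(1)] by simp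
  then have W_fm: "{x \<in> K. 1 < \<bar>P x\<bar>} \<in> fmeasurable lborel"
    by (intro fmeasurableI2[OF fmeasurable_compact[OF K(1)]]) auto
  have "(\<integral>\<^sup>+x. indicator ((*\<^sub>R) \<sigma> ` K) x \<partial>lborel) \<le> (\<integral>\<^sup>+x. indicator {x \<in> K. 1 < \<bar>P x\<bar>} x \<partial>(lborel :: 'a measure))"
  proof (rule nn_integral_mono_on_rays)
    fix v :: 'a
    assume "v \<noteq> 0"
    obtain q where "degree q \<le> d" "\<And>s. P (s *\<^sub>R v) = poly q s"
      using ray[of v] by blast
    then show "(\<integral>\<^sup>+s. ennreal (s ^ (DIM('a) - 1)) * indicator ((*\<^sub>R) \<sigma> ` K) (s *\<^sub>R v) * indicator {0<..} s \<partial>lborel)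
      \<le> (\<integral>\<^sup>+s. ennreal (s ^ (DIM('a) - 1)) * indicator {x \<in> K. 1 < \<bar>P x\<bar>} (s *\<^sub>R v) * indicator {0<..} s \<partial>lborel)"
      using \<open>v \<noteq> 0\<close> by (intro ray_comparison_of_large_value[where P = P, OF \<open>0 < d\<close> K _ _ _ \<sigma> large])
  qed (use \<sigma>K W in auto)
  then have "emeasure lborel ((*\<^sub>R) \<sigma> ` K) \<le> emeasure lborel {x \<in> K. 1 < \<bar>P x\<bar>}"
    using \<sigma>K W by simp
  then have "measure lborel ((*\<^sub>R) \<sigma> ` K) \<le> measure lborel {x \<in> K. 1 < \<bar>P x\<bar>}"
    using \<sigma>K W_fm by (simp add: emeasure_eq_measure2)
  then have "measure lebesgue ((*\<^sub>R) \<sigma> ` K) \<le> measure lebesgue {x \<in> K. 1 < \<bar>P x\<bar>}"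
    using \<sigma>K W by (simp add: measure_completion)
  then show ?thesis
    using measure_lebesgue_affine[of \<sigma> 0 K] \<sigma> by (simp add: image_def)
qed

text \<open>
  If \<open>|P x|\<close> exceeded the bound belonging to some \<open>\<tau> > \<sigma> = (1 - \<omega>)\<^sup>1\<^sup>/\<^sup>n\<close>, then the set where \<open>|P| > 1\<close>
  would have at least the measure of a copy of \<open>K\<close> shrunk by the factor \<open>\<tau>\<close>, that is, more than the fraction
  \<open>1 - \<omega>\<close> of \<open>K\<close>. Passing to the limit \<open>\<tau> \<rightarrow> \<sigma>\<close> at the end makes it possible to work with non-strict
  inequalities between integrals, and to keep \<open>\<tau>\<close> positive when \<open>\<omega> = 1\<close>.
\<close>
theorem brudnyi_ganzburg_inequality:
  fixes K :: "'a::euclidean_space set" and P :: "'a \<Rightarrow> real"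
  assumes "0 < d" and K: "compact K" "convex K" "0 < measure lebesgue K" and P: "continuous_on UNIV P"
    and line: "\<And>a v. \<exists>q. degree q \<le> d \<and> (\<forall>s. P (a + s *\<^sub>R v) = poly q s)"
    and \<omega>: "0 < \<omega>" "\<omega> \<le> 1" "\<omega> * measure lebesgue K \<le> measure lebesgue {x \<in> K. \<bar>P x\<bar> \<le> 1}"
    and "x \<in> K"
  shows "\<bar>P x\<bar> \<le> poly (chebyshev_poly d) ((1 + root DIM('a) (1 - \<omega>)) / (1 - root DIM('a) (1 - \<omega>)))"
proof -
  define \<sigma> where "\<sigma> = root DIM('a) (1 - \<omega>)"
  have "0 \<le> \<sigma>"
    unfolding \<sigma>_def using \<omega>(2) by (intro real_root_ge_zero) simp
  have "\<sigma> < 1"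
    unfolding \<sigma>_def using \<omega>(1) by (subst real_root_lt_1_iff) simp_all
  have pow: "\<sigma> ^ DIM('a) = 1 - \<omega>"
    unfolding \<sigma>_def using \<omega>(2) by (intro real_root_pow_pos2) simp_all
  have bound: "\<bar>P x\<bar> \<le> poly (chebyshev_poly d) ((1 + \<tau>) / (1 - \<tau>))" if \<tau>: "\<sigma> < \<tau>" "\<tau> < 1" for \<tau>
  proof (rule ccontr)
    assume large: "\<not> ?thesis"
    define L where "L = (+) (- x) ` K"
    have "compact L" "convex L"
      unfolding L_def by (rule compact_translation[OF K(1)], rule convex_translation[OF K(2)])
    moreover have "0 \<in> L"
      using \<open>x \<in> K\<close> by (force simp: L_def)
    ultimately have "\<tau> ^ DIM('a) * measure lebesgue L \<le> measure lebesgue {y \<in> L. 1 < \<bar>P (x + y)\<bar>}"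
      using \<open>0 < d\<close> line large \<tau> \<open>0 \<le> \<sigma>\<close> P
      by (intro measure_superlevel_ge_of_large_value[of d L "\<lambda>y. P (x + y)" \<tau>])
         (auto intro!: continuous_on_compose2[OF P] continuous_on_add)
    moreover have "{y \<in> L. 1 < \<bar>P (x + y)\<bar>} = (+) (- x) ` {y \<in> K. 1 < \<bar>P y\<bar>}"
      by (auto simp: L_def)
    ultimately have super: "\<tau> ^ DIM('a) * measure lebesgue K \<le> measure lebesgue {y \<in> K. 1 < \<bar>P y\<bar>}"
      unfolding L_def by (simp only: measure_translation)
    have "closed {y. \<bar>P y\<bar> \<le> 1}"
      using P by (intro closed_Collect_le continuous_intros)
    then have V: "K \<inter> {y. \<bar>P y\<bar> \<le> 1} \<in> lmeasurable"
      using K by (intro lmeasurable_compact compact_Int_closed)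
    have "measure lebesgue (K - K \<inter> {y. \<bar>P y\<bar> \<le> 1})
        = measure lebesgue K - measure lebesgue (K \<inter> {y. \<bar>P y\<bar> \<le> 1})"
      using V K by (intro measurable_measure_Diff) (auto intro: lmeasurable_compact fmeasurableD)
    moreover have "K - K \<inter> {y. \<bar>P y\<bar> \<le> 1} = {y \<in> K. 1 < \<bar>P y\<bar>}"
      "K \<inter> {y. \<bar>P y\<bar> \<le> 1} = {y \<in> K. \<bar>P y\<bar> \<le> 1}"
      by auto
    ultimately have "\<tau> ^ DIM('a) * measure lebesgue K \<le> (1 - \<omega>) * measure lebesgue K"
      using super \<omega>(3) by (simp add: algebra_simps)
    then have "\<tau> ^ DIM('a) \<le> \<sigma> ^ DIM('a)"
      using K(3) pow by simp
    moreover have "\<sigma> ^ DIM('a) < \<tau> ^ DIM('a)"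
      using \<tau> \<open>0 \<le> \<sigma>\<close> by (intro power_strict_mono) auto
    ultimately show False
      by simp
  qed
  have "((\<lambda>\<tau>. poly (chebyshev_poly d) ((1 + \<tau>) / (1 - \<tau>))) \<longlongrightarrow>
      poly (chebyshev_poly d) ((1 + \<sigma>) / (1 - \<sigma>))) (at_right \<sigma>)"
    using \<open>\<sigma> < 1\<close> by (intro tendsto_intros) auto
  moreover have "\<forall>\<^sub>F \<tau> in at_right \<sigma>. \<bar>P x\<bar> \<le> poly (chebyshev_poly d) ((1 + \<tau>) / (1 - \<tau>))"
    using bound \<open>\<sigma> < 1\<close> by (auto simp: eventually_at_right_field)
  ultimately show ?thesis
    unfolding \<sigma>_def[symmetric] by (rule tendsto_lowerbound) simp
qed

section \<open>Polynomials in several variables\<close>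

lemma continuous_on_polynomial_of_degree_le:
  "polynomial_of_degree_le d P \<Longrightarrow> continuous_on A P"
  unfolding polynomial_of_degree_le_def by (elim exE) (simp, intro continuous_intros)

lemma polynomial_of_degree_le_on_line:
  fixes P :: "real ^ 'n \<Rightarrow> real"
  assumes "polynomial_of_degree_le d P"
  shows "\<exists>q. degree q \<le> d \<and> (\<forall>s. P (a + s *\<^sub>R v) = poly q s)"
proof -
  obtain c where c: "\<And>x. P x = (\<Sum>\<alpha> | (\<Sum>i\<in>UNIV. \<alpha> i) \<le> d. c \<alpha> * (\<Prod>i\<in>UNIV. x $ i ^ \<alpha> i))"
    using assms unfolding polynomial_of_degree_le_def by blast
  define q where
    "q = (\<Sum>\<alpha> | (\<Sum>i\<in>UNIV. \<alpha> i) \<le> d. smult (c \<alpha>) (\<Prod>i\<in>UNIV. [:a $ i, v $ i:] ^ \<alpha> i))"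
  have "degree (\<Prod>i\<in>UNIV. [:a $ i, v $ i:] ^ \<alpha> i) \<le> d" if "(\<Sum>i\<in>UNIV. \<alpha> i) \<le> d" for \<alpha> :: "'n \<Rightarrow> nat"
  proof -
    have "degree ([:a $ i, v $ i:] ^ \<alpha> i) \<le> \<alpha> i" for i
      using degree_power_le[of "[:a $ i, v $ i:]" "\<alpha> i"] by (auto split: if_splits)
    then have "degree (\<Prod>i\<in>UNIV. [:a $ i, v $ i:] ^ \<alpha> i) \<le> (\<Sum>i\<in>UNIV. \<alpha> i)"
      by (intro order_trans[OF degree_prod_sum_le] sum_mono) auto
    then show ?thesis
      using that by simp
  qed
  then have "degree q \<le> d"
    unfolding q_def
    by (intro degree_sum_le finite_multiindices) (auto intro: order_trans[OF degree_smult_le])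
  moreover have "P (a + s *\<^sub>R v) = poly q s" for s
    by (simp add: c q_def poly_sum poly_prod mult.commute)
  ultimately show ?thesis
    by blast
qed

section \<open>Metric span and Remez span\<close>

lemma covering_number_mono:
  fixes A B :: "(real ^ 'n) set"
  assumes "A \<subseteq> B" "bounded B" "0 < e"
  shows "covering_number e A \<le> covering_number e B"
proof -
  obtain Q where "finite Q" "card Q = covering_number e B"
      "Q \<subseteq> range (\<lambda>a. cbox a (a + vec e))" "B \<subseteq> \<Union>Q"
    using covering_number_attained[OF assms(2,3)] by blast
  then show ?thesis
    using assms(1) unfolding covering_number_def[of e A] by (intro Least_le) blast
qed

text \<open>
  Vitushkin's bound for the sublevel set says that whatever the covering number of \<open>Z\<close> has in
  excess of \<open>M\<^sub>d(\<epsilon>)\<close> must come from volume.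
\<close>
lemma metric_span_le_measure_sublevel:
  fixes Z :: "(real ^ 'n) set"
  assumes C: "vitushkin_constants TYPE('n) d C" and P: "polynomial_of_degree_le d P" "0 \<le> \<rho>"
    and Z: "Z \<subseteq> sublevel \<rho> P"
  shows "metric_span C Z \<le> ereal (measure lebesgue (sublevel \<rho> P))"
  unfolding metric_span_def
proof (rule SUP_least)
  fix e :: real
  assume "e \<in> {0<..}"
  then have "0 < e" by simp
  have "bounded (sublevel \<rho> P)"
    unfolding sublevel_def by (rule bounded_subset[OF bounded_cbox]) auto
  then have "real (covering_number e Z) \<le> real (covering_number e (sublevel \<rho> P))"
    using covering_number_mono[OF Z _ \<open>0 < e\<close>] by simp
  also have "\<dots> \<le> vitushkin_sum CARD('n) C e + measure lebesgue (sublevel \<rho> P) / e ^ CARD('n)"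
    using C P \<open>0 < e\<close> unfolding vitushkin_constants_def by blast
  finally have "real (covering_number e Z) - vitushkin_sum CARD('n) C e
      \<le> measure lebesgue (sublevel \<rho> P) / e ^ CARD('n)"
    by simp
  then show "ereal (e ^ CARD('n) * (real (covering_number e Z) - vitushkin_sum CARD('n) C e))
      \<le> ereal (measure lebesgue (sublevel \<rho> P))"
    using \<open>0 < e\<close> by (simp add: pos_le_divide_eq mult.commute)
qed

theorem theorem1p3:
  fixes Z :: "(real ^ 'n) set" and d :: nat and C :: "nat \<Rightarrow> real" and \<omega> :: real
  assumes "d \<ge> 1"
    and "vitushkin_constants TYPE('n) d C"
    and "Z \<subseteq> cbox 0 1"
    and "metric_span C Z = ereal \<omega>"
    and "\<omega> > 0"
  shows "remez_span d Z < \<infinity> \<and>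
         remez_span d Z \<le> ereal (poly (chebyshev_poly d)
           ((1 + root CARD('n) (1 - \<omega>)) / (1 - root CARD('n) (1 - \<omega>))))"
proof -
  let ?T = "poly (chebyshev_poly d) ((1 + root CARD('n) (1 - \<omega>)) / (1 - root CARD('n) (1 - \<omega>)))"
  have unit: "measure lebesgue (cbox 0 1 :: (real ^ 'n) set) = 1"
  proof -
    have "(0 :: real ^ 'n) \<in> cbox 0 1"
      by (simp add: mem_box_cart)
    then have "cbox 0 1 \<noteq> ({} :: (real ^ 'n) set)"
      by blast
    then show ?thesis
      by (simp add: content_cbox_if_cart)
  qed
  have "remez_constant d Z ?T"
    unfolding remez_constant_def
  proof (intro allI impI ballI)
    fix P :: "real ^ 'n \<Rightarrow> real" and x :: "real ^ 'n"
    assume P: "polynomial_of_degree_le d P" and "\<forall>x\<in>Z. \<bar>P x\<bar> \<le> 1" and x: "x \<in> cbox 0 1"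
    then have "Z \<subseteq> sublevel 1 P"
      using assms(3) by (auto simp: sublevel_def)
    then have span: "\<omega> \<le> measure lebesgue (sublevel 1 P)"
      using metric_span_le_measure_sublevel[OF assms(2) P, of 1 Z] assms(4) by simp
    have "measure lebesgue (sublevel 1 P) \<le> measure lebesgue (cbox 0 1 :: (real ^ 'n) set)"
    proof (rule measure_mono_fmeasurable)
      have "closed {y. \<bar>P y\<bar> \<le> 1}"
        using continuous_on_polynomial_of_degree_le[OF P] by (intro closed_Collect_le continuous_intros)
      then have "compact (cbox 0 1 \<inter> {y. \<bar>P y\<bar> \<le> 1})"
        by (intro compact_Int_closed compact_cbox)
      moreover have "sublevel 1 P = cbox 0 1 \<inter> {y. \<bar>P y\<bar> \<le> 1}"
        by (auto simp: sublevel_def)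
      ultimately show "sublevel 1 P \<in> sets lebesgue"
        by (auto intro: fmeasurableD lmeasurable_compact)
    qed (auto simp: sublevel_def)
    then have "\<omega> \<le> 1"
      using span unit by simp
    have "\<bar>P x\<bar> \<le> poly (chebyshev_poly d)
        ((1 + root DIM(real ^ 'n) (1 - \<omega>)) / (1 - root DIM(real ^ 'n) (1 - \<omega>)))"
    proof (rule brudnyi_ganzburg_inequality[of d "cbox 0 1"])
      show "\<omega> * measure lebesgue (cbox 0 1 :: (real ^ 'n) set) \<le> measure lebesgue {x \<in> cbox 0 1. \<bar>P x\<bar> \<le> 1}"
        using span unit by (simp add: sublevel_def)
    qed (use assms \<open>\<omega> \<le> 1\<close> unit x polynomial_of_degree_le_on_line[OF P]
          continuous_on_polynomial_of_degree_le[OF P] in auto)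
    then show "\<bar>P x\<bar> \<le> ?T"
      by simp
  qed
  then show ?thesis
    using remez_constant_Least(2)[of d Z ?T] by (auto simp: remez_span_def definite_def)
qed

end
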